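(* For every $n\ge 0$, \[ \nu_2(t_6(n))=\nu_2\binom{n+5}{5}+\mathbf 1_{n\equiv 3\ (\mathrm{mod}\ 4)}. \] Moreover, for every integer $s\ge 1$, the sequence $\bigl(\operatorname{odd}(t_6(n))\bmod 2^s\bigr)_{n\ge 0}$ is $2$-automatic.
   Context: Let $T(x)=\prod_{j\ge 0}(1-x^{2^j})\in\mathbb Z[[x]]$ be the Thue--Morse generating function, and define the integers $t_6(n)$ by $T(x)^6=\sum_{n\ge 0}t_6(n)x^n$. For a nonzero integer $a$, $\nu_2(a)$ is the largest integer $v$ such that $2^v$ divides $a$, and $\nu_2(0)=+\infty$. The signed odd part is $\operatorname{odd}(a)=a/2^{\nu_2(a)}$ for $a\neq 0$ and $\operatorname{odd}(0)=0$. For a statement $\mathcal E$, $\mathbf 1_{\mathcal E}$ is $1$ if $\mathcal E$ holds and $0$ otherwise. A sequence $(a_n)_{n\ge 0}$ with values in a finite set is $2$-automatic if there is a finite automaton which, reading the binary expansion of $n$ from the most significant digit, outputs $a_n$; equivalently, its $2$-kernel $\{(a_{2^e n+c})_{n\ge 0}: e\ge 0,\ 0\le c<2^e\}$ is finite. *)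

theory Defs
  imports
    "HOL-Analysis.Infinite_Products"
    "HOL-Computational_Algebra.Formal_Power_Series"
    "HOL-Library.Extended_Nat"
    "HOL-Number_Theory.Cong"
begin

text \<open>
  The infinite product is taken in the topology of formal power series. Convergence,
  without which \<^const>\<open>prodinf\<close> would be an unspecified value, is
  \<open>thue_morse_fps_has_prod\<close> below.
\<close>
definition thue_morse_fps :: "int fps" where
  "thue_morse_fps = prodinf (\<lambda>j. 1 - fps_X ^ (2 ^ j))"

definition t6 :: "nat \<Rightarrow> int" where
  "t6 n = fps_nth (thue_morse_fps ^ 6) n"

text \<open>The library sets \<^term>\<open>multiplicity p 0\<close> to 0, whereas here the valuation of 0 is infinite.\<close>
definition nu2 :: "int \<Rightarrow> enat" where
  "nu2 a = (if a = 0 then \<infinity> else enat (multiplicity 2 a))"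

definition odd_part :: "int \<Rightarrow> int" where
  "odd_part a = (if a = 0 then 0 else a div 2 ^ multiplicity 2 a)"

text \<open>Most significant digit first, without leading zeros; the expansion of 0 is the empty word.\<close>
fun binary_digits :: "nat \<Rightarrow> nat list" where
  "binary_digits n = (if n = 0 then [] else binary_digits (n div 2) @ [n mod 2])"

declare binary_digits.simps [simp del]

text \<open>
  A deterministic finite automaton with state set \<open>Q\<close>, initial state \<open>q0\<close>, transition
  function \<open>\<delta>\<close> and output function \<open>\<tau>\<close>. Taking the states to be natural numbers is no
  restriction, as every finite set can be numbered. The sequence then takes only finitely
  many values, namely in the image of \<open>Q\<close> under \<open>\<tau>\<close>.
\<close>
definition two_automatic :: "(nat \<Rightarrow> 'a) \<Rightarrow> bool" where
  "two_automatic a \<longleftrightarrow>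
     (\<exists>(Q :: nat set) q0 (\<delta> :: nat \<Rightarrow> nat \<Rightarrow> nat) (\<tau> :: nat \<Rightarrow> 'a).
        finite Q \<and> q0 \<in> Q \<and> (\<forall>q\<in>Q. \<forall>d\<in>{0, 1}. \<delta> q d \<in> Q) \<and>
        (\<forall>n. a n = \<tau> (foldl \<delta> q0 (binary_digits n))))"

lemma thue_morse_fps_has_prod:
  "(\<lambda>j. 1 - fps_X ^ (2 ^ j) :: int fps) has_prod thue_morse_fps"
proof -
  define P :: "nat \<Rightarrow> int fps" where "P = (\<lambda>N. \<Prod>j\<le>N. 1 - fps_X ^ (2 ^ j))"
  define L where "L = Abs_fps (\<lambda>n. fps_nth (P n) n)"
  have stable: "fps_nth (P N) n = fps_nth (P n) n" if "n \<le> N" for n N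
    using that
  proof (induction N rule: dec_induct)
    case (step N)
    have "n < 2 ^ Suc N"
      using le_less_trans[OF step.hyps(1) less_trans[OF lessI less_exp]] .
    moreover have "P (Suc N) = P N - P N * fps_X ^ (2 ^ Suc N)"
      by (simp add: P_def algebra_simps)
    ultimately have "fps_nth (P (Suc N)) n = fps_nth (P N) n"
      by (simp add: fps_X_power_mult_right_nth del: power_Suc)
    with step.IH show ?case by simp
  qed simp
  have "P \<longlonglongrightarrow> L"
  proof (rule tendsto_fpsI)
    fix n
    show "eventually (\<lambda>N. fps_nth (P N) n = fps_nth L n) sequentially"
      using eventually_ge_at_top[of n]
      by eventually_elim (unfold L_def fps_nth_Abs_fps, rule stable)
  qed
  moreover have "fps_nth L 0 = 1"
    by (simp add: L_def P_def)
  hence "L \<noteq> 0" by (metis fps_zero_nth zero_neq_one)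
  ultimately have "(\<lambda>j. 1 - fps_X ^ (2 ^ j) :: int fps) has_prod L"
    by (simp add: has_prod_def raw_has_prod_def P_def)
  thus ?thesis
    unfolding thue_morse_fps_def by (subst has_prod_unique [symmetric]) assumption+
qed

end

theory Submission
  imports Defs
begin

text \<open>
  From \<open>T(x) = (1 - x) T(x\<^sup>2)\<close> one gets \<open>T(x)\<^sup>6 = (1 - x)\<^sup>6 T(x\<^sup>2)\<^sup>6\<close>, so the vector
  \<open>(t\<^sub>6(m - 1), \<dots>, t\<^sub>6(m - 5))\<close> is multiplied by a fixed integer matrix when \<open>m\<close> is doubled.
  The 2-adic slopes of its characteristic polynomial are \<open>1, 3, 3, 4, 4\<close>: one eigenvalue, of
  valuation 1, dominates. Hence \<open>t\<^sub>6(2\<^sup>k u - j)\<close>, for \<open>u\<close> odd and \<open>1 \<le> j \<le> 5\<close>, is \<open>2\<^sup>k\<close> times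
  a quantity that satisfies an integral recurrence in \<open>k\<close> and whose valuation is constant for
  \<open>k\<close> not too small. Every \<open>n\<close> has some \<open>n + j\<close> divisible by 4, and the zeros \<open>-1, \<dots>, -5\<close> of
  \<open>n \<mapsto> binomial (n + 5) 5\<close> account for the same valuation up to a
  constant depending on \<open>j\<close>. The normalised quantities modulo a power
  of 2 are updated by reading a binary digit and determine the odd part.
\<close>

section \<open>The functional equation\<close>

lemma fps_eq_nth_cutoff_mult:
  fixes F G K :: "'a::comm_ring_1 fps"
  assumes "\<And>i. i \<le> n \<Longrightarrow> fps_nth F i = fps_nth G i"
  shows "fps_nth (K * F) n = fps_nth (K * G) n"
  using assms by (simp add: fps_mult_nth)

lemma fps_nth_compose_X_square:
  fixes F :: "'a::comm_ring_1 fps"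
  shows "fps_nth (F oo fps_X ^ 2) n = (if even n then fps_nth F (n div 2) else 0)"
proof -
  have "fps_nth (F oo fps_X ^ 2) n = (\<Sum>i\<le>n. if n = 2 * i then fps_nth F i else 0)"
    unfolding fps_compose_nth
    by (intro sum.cong) (auto simp: fps_X_power_nth simp flip: power_mult)
  also have "\<dots> = (\<Sum>i\<in>{..n} \<inter> {i. n = 2 * i}. fps_nth F i)"
    by (simp add: sum.inter_restrict)
  also have "{..n} \<inter> {i. n = 2 * i} = (if even n then {n div 2} else {})"
    by auto
  finally show ?thesis by simp
qed

lemma thue_morse_fps_nth_eventually:
  "eventually (\<lambda>N. fps_nth (\<Prod>j\<le>N. 1 - fps_X ^ (2 ^ j)) n = fps_nth thue_morse_fps n) sequentially"
proof -
  have "(\<lambda>N. \<Prod>j\<le>N. 1 - fps_X ^ (2 ^ j)) \<longlonglongrightarrow> thue_morse_fps"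
    using thue_morse_fps_has_prod by (rule has_prod_imp_tendsto)
  thus ?thesis by (simp add: tendsto_fps_iff)
qed

lemma t6_0: "t6 0 = 1"
proof -
  have "fps_nth (\<Prod>j\<le>N. 1 - fps_X ^ (2 ^ j) :: int fps) 0 = 1" for N
    by (induction N) simp_all
  hence "fps_nth thue_morse_fps 0 = 1"
    using thue_morse_fps_nth_eventually[of 0] by simp
  thus ?thesis by (simp add: t6_def fps_nth_power_0)
qed

text \<open>Substituting \<open>fps_X ^ 2\<close> shifts the factors by one index and so loses only
  the factor for \<open>j = 0\<close>. Each coefficient is settled by a partial product, where the
  shift is a finite identity.\<close>

lemma thue_morse_fps_functional_equation:
  "thue_morse_fps = (1 - fps_X) * (thue_morse_fps oo fps_X ^ 2)"
proof (rule fps_ext)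
  fix n
  define P :: "nat \<Rightarrow> int fps" where "P = (\<lambda>N. \<Prod>j\<le>N. 1 - fps_X ^ (2 ^ j))"
  have factor: "(1 - fps_X ^ (2 ^ j)) oo fps_X ^ 2 = (1 - fps_X ^ (2 ^ Suc j) :: int fps)" for j
  proof -
    have "(fps_X ^ (2 ^ j) :: int fps) oo fps_X ^ 2 = fps_X ^ (2 ^ Suc j)"
      by (subst fps_compose_power [symmetric]) (simp_all add: power_mult [symmetric])
    thus ?thesis by (simp add: fps_compose_sub_distrib)
  qed
  have P_Suc: "P (Suc N) = (1 - fps_X) * (P N oo fps_X ^ 2)" for N
  proof -
    have "P N oo fps_X ^ 2 = (\<Prod>j\<le>N. 1 - fps_X ^ (2 ^ Suc j))"
      unfolding P_def by (subst fps_compose_prod_distrib) (simp_all only: factor, simp)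
    thus ?thesis
      unfolding P_def by (subst prod.atMost_Suc_shift) simp
  qed
  have "eventually (\<lambda>N. \<forall>i\<in>{..n}. fps_nth (P N) i = fps_nth thue_morse_fps i) sequentially"
    unfolding P_def by (intro eventually_ball_finite ballI thue_morse_fps_nth_eventually) simp
  then obtain N where N: "\<And>M i. M \<ge> N \<Longrightarrow> i \<le> n \<Longrightarrow> fps_nth (P M) i = fps_nth thue_morse_fps i"
    by (auto simp: eventually_sequentially)
  have "fps_nth thue_morse_fps n = fps_nth ((1 - fps_X) * (P N oo fps_X ^ 2)) n"
    using N[of "Suc N" n] P_Suc by simp
  \<comment> \<open>Only coefficients of index at most \<open>n div 2\<close> enter the composition,
    and there \<open>P N\<close> already agrees with the limit.\<close>
  also have "\<dots> = fps_nth ((1 - fps_X) * (thue_morse_fps oo fps_X ^ 2)) n"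
    by (rule fps_eq_nth_cutoff_mult) (auto simp: fps_nth_compose_X_square intro!: N)
  finally show "fps_nth thue_morse_fps n = fps_nth ((1 - fps_X) * (thue_morse_fps oo fps_X ^ 2)) n" .
qed

text \<open>Extending by zero to negative indices makes the recursions hold without side conditions.\<close>
definition t6_int :: "int \<Rightarrow> int" where
  "t6_int i = (if i < 0 then 0 else t6 (nat i))"

lemma t6_halving:
  "t6 n = (\<Sum>k\<le>6. (-1) ^ k * int (6 choose k) *
     (if k \<le> n \<and> even (n - k) then t6 ((n - k) div 2) else 0))"
proof -
  have "thue_morse_fps ^ 6 = (1 - fps_X) ^ 6 * (thue_morse_fps ^ 6 oo fps_X ^ 2)"
    by (subst thue_morse_fps_functional_equation)
       (simp add: power_mult_distrib fps_compose_power)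
  also have "(1 - fps_X :: int fps) ^ 6 = (\<Sum>k\<le>6. fps_const ((-1) ^ k * int (6 choose k)) * fps_X ^ k)"
    using binomial_ring[of "- fps_X" "1 :: int fps" 6]
    by (simp add: power_minus[of "fps_X :: int fps"] mult_ac fps_const_mult [symmetric]
          fps_of_nat fps_const_power [symmetric] fps_const_neg [symmetric]
          del: fps_const_mult fps_const_neg fps_const_power)
  finally have "t6 n = fps_nth ((\<Sum>k\<le>6. fps_const ((-1) ^ k * int (6 choose k)) * fps_X ^ k) *
      (thue_morse_fps ^ 6 oo fps_X ^ 2)) n"
    unfolding t6_def by (rule arg_cong)
  also have "\<dots> = (\<Sum>k\<le>6. fps_nth (fps_const ((-1) ^ k * int (6 choose k)) *
      (fps_X ^ k * (thue_morse_fps ^ 6 oo fps_X ^ 2))) n)"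
    by (simp add: sum_distrib_right fps_sum_nth mult.assoc)
  also have "\<dots> = (\<Sum>k\<le>6. (-1) ^ k * int (6 choose k) *
     (if k \<le> n \<and> even (n - k) then t6 ((n - k) div 2) else 0))"
    by (intro sum.cong refl)
       (auto simp add: t6_def fps_X_power_mult_nth fps_nth_compose_X_square
          simp del: fps_const_mult fps_const_neg fps_const_power)
  finally show ?thesis .
qed

section \<open>Doubling recursions and parity\<close>

lemma t6_int_halving:
  "t6_int i = (\<Sum>k\<in>{0,1,2,3,4,5,6}. (-1) ^ k * int (6 choose k) *
     (if even (i - int k) then t6_int ((i - int k) div 2) else 0))"
proof (cases "i < 0")
  case True
  hence "t6_int ((i - int k) div 2) = 0" for k by (simp add: t6_int_def)
  with True show ?thesis by (simp add: t6_int_def cong: if_cong)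
next
  case False
  then obtain n where [simp]: "i = int n"
    using zero_le_imp_eq_int by force
  have "(if k \<le> n \<and> even (n - k) then t6 ((n - k) div 2) else 0) =
    (if even (i - int k) then t6_int ((i - int k) div 2) else 0)" for k
  proof (cases "k \<le> n")
    case True
    have "i - int k = int (n - k)" using True by simp
    thus ?thesis using True
      by (simp add: t6_int_def nat_div_distrib del: of_nat_diff)
  next
    case False
    \<comment> \<open>The guard \<open>k \<le> n\<close> on natural numbers becomes a negative
      index, where \<open>t6_int\<close> is 0.\<close>
    hence "(i - int k) div 2 < 0" by simp
    thus ?thesis using False by (simp add: t6_int_def)
  qed
  moreover have "{..6} = {0,1,2,3,4,5,6::nat}" by auto
  moreover have "t6_int i = t6 n" by (simp add: t6_int_def)
  ultimately show ?thesis using t6_halving[of n] by presburger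
qed

lemma t6_int_double:
  "t6_int (2 * m) = t6_int m + 15 * t6_int (m - 1) + 15 * t6_int (m - 2) + t6_int (m - 3)"
  "t6_int (2 * m + 1) = - 6 * t6_int m - 20 * t6_int (m - 1) - 6 * t6_int (m - 2)"
proof -
  have choose: "(6::nat) choose 1 = 6" "(6::nat) choose 2 = 15" "(6::nat) choose 3 = 20"
    "(6::nat) choose 4 = 15" "(6::nat) choose 5 = 6" "(6::nat) choose 6 = 1"
    by (simp_all add: eval_nat_numeral)
  have half: "(2 * m - 2) div 2 = m - 1" "(2 * m - 4) div 2 = m - 2" "(2 * m - 6) div 2 = m - 3"
    by simp_all
  show "t6_int (2 * m) = t6_int m + 15 * t6_int (m - 1) + 15 * t6_int (m - 2) + t6_int (m - 3)"
    by (subst t6_int_halving) (simp add: choose half)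
  have half: "(2 * m + 1 - 1) div 2 = m" "(2 * m + 1 - 3) div 2 = m - 1" "(2 * m + 1 - 5) div 2 = m - 2"
    by simp_all
  show "t6_int (2 * m + 1) = - 6 * t6_int m - 20 * t6_int (m - 1) - 6 * t6_int (m - 2)"
    by (subst t6_int_halving) (simp add: choose half)
qed

lemma t6_int_double_minus:
  "t6_int (2 * m - 1) = - 6 * t6_int (m - 1) - 20 * t6_int (m - 2) - 6 * t6_int (m - 3)"
  "t6_int (2 * m - 2) = t6_int (m - 1) + 15 * t6_int (m - 2) + 15 * t6_int (m - 3) + t6_int (m - 4)"
  "t6_int (2 * m - 3) = - 6 * t6_int (m - 2) - 20 * t6_int (m - 3) - 6 * t6_int (m - 4)"
  "t6_int (2 * m - 4) = t6_int (m - 2) + 15 * t6_int (m - 3) + 15 * t6_int (m - 4) + t6_int (m - 5)"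
  "t6_int (2 * m - 5) = - 6 * t6_int (m - 3) - 20 * t6_int (m - 4) - 6 * t6_int (m - 5)"
  using t6_int_double(1)[of "m - 1"] t6_int_double(1)[of "m - 2"]
    t6_int_double(2)[of "m - 1"] t6_int_double(2)[of "m - 2"] t6_int_double(2)[of "m - 3"]
  by (simp_all add: algebra_simps)

text \<open>
  By \<open>t6_int_double_minus\<close>, passing from \<open>m\<close> to \<open>2 m\<close> is a linear map on the vector of the
  \<open>t6_int (m - j)\<close>, \<open>1 \<le> j \<le> 5\<close>. The recurrence is Cayley-Hamilton for this map, whose
  characteristic polynomial is \<open>(X\<^sup>3 + 10 X\<^sup>2 - 96 X - 512) (X\<^sup>2 - 8 X - 64)\<close>.
\<close>
lemma t6_int_dyadic_recurrence:
  assumes "j \<in> {1..5}"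
  shows "t6_int (32 * m - j) = - 2 * t6_int (16 * m - j) + 240 * t6_int (8 * m - j)
    + 384 * t6_int (4 * m - j) - 10240 * t6_int (2 * m - j) - 32768 * t6_int (m - j)"
proof -
  have "j = 1 \<or> j = 2 \<or> j = 3 \<or> j = 4 \<or> j = 5" using assms by auto
  thus ?thesis
    using t6_int_double_minus[of m] t6_int_double_minus[of "2 * m"] t6_int_double_minus[of "4 * m"]
      t6_int_double_minus[of "8 * m"] t6_int_double_minus[of "16 * m"]
    by (elim disjE) simp_all
qed

text \<open>Descent modulo 2: the recursions leave two pairs of terms. One pair has odd indices and
  is even; the other is the same sum for \<open>i div 2\<close>. The descent ends at
  \<open>t6 0 = 1\<close>.\<close>

lemma odd_t6_int_sum:
  assumes "odd m" "m > 0"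
  shows "odd (t6_int (m - 1) + t6_int (m - 5))"
proof -
  have even_odd: "even (t6_int (2 * i + 1))" for i
    by (simp add: t6_int_double(2))
  have "odd (t6_int (2 * i) + t6_int (2 * i - 4))" if "i \<ge> 0" for i
    using that
  proof (induction "nat i" arbitrary: i rule: less_induct)
    case less
    \<comment> \<open>The terms at \<open>i - 2\<close> and \<open>i - 3\<close> occur in both
      recursions and cancel modulo 2.\<close>
    have *: "even (t6_int (2 * i) + t6_int (2 * i - 4)) \<longleftrightarrow>
       even (t6_int i + t6_int (i - 1) + t6_int (i - 4) + t6_int (i - 5))"
      using t6_int_double(1)[of i] t6_int_double_minus(4)[of i] by simp presburger
    show ?case
    proof (cases "i = 0")
      case True
      thus ?thesis by (simp add: t6_int_def t6_0)
    next
      case False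
      define k where "k = i div 2"
      have k: "nat k < nat i" "k \<ge> 0" using less.prems False by (auto simp: k_def)
      consider "i = 2 * k" | "i = 2 * k + 1" unfolding k_def by linarith
      thus ?thesis
      proof cases
        case 1
        have "even (t6_int (i - 1))" "even (t6_int (i - 5))"
          using even_odd[of "k - 1"] even_odd[of "k - 3"] 1 by (simp_all add: algebra_simps)
        with * less.hyps[OF k] 1 show ?thesis by simp
      next
        case 2
        have "even (t6_int i)" "even (t6_int (i - 4))"
          using even_odd[of "k"] even_odd[of "k - 2"] 2 by (simp_all add: algebra_simps)
        with * less.hyps[OF k] 2 show ?thesis by simp
      qed
    qed
  qed
  from this[of "(m - 1) div 2"] assms show ?thesis by (auto elim!: oddE)
qed

section \<open>Normalised coefficients\<close>

text \<open>Dividing \<open>f k\<close> by \<open>2 ^ k\<close> turns the coefficients into -1, 60,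
  48, -640, -1024, still integers. The factor 16 settles \<open>k \<le> 4\<close>.\<close>

lemma dyadic_recurrence_dvd:
  fixes f :: "nat \<Rightarrow> int"
  assumes rec: "\<And>k. f (k + 5) = - 2 * f (k + 4) + 240 * f (k + 3) + 384 * f (k + 2)
    - 10240 * f (k + 1) - 32768 * f k"
  shows "2 ^ k dvd 16 * f k"
proof (induction k rule: less_induct)
  case (less k)
  show ?case
  proof (cases "k < 5")
    case True
    hence "(2 :: int) ^ k dvd 2 ^ 4" by (intro le_imp_power_dvd) simp
    thus ?thesis by simp
  next
    case False
    define l where "l = k - 5"
    have k: "k = l + 5" using False by (simp add: l_def)
    obtain a0 a1 a2 a3 a4 where
      "16 * f l = 2 ^ l * a0" "16 * f (l + 1) = 2 ^ (l + 1) * a1" "16 * f (l + 2) = 2 ^ (l + 2) * a2"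
      "16 * f (l + 3) = 2 ^ (l + 3) * a3" "16 * f (l + 4) = 2 ^ (l + 4) * a4"
      using less.IH[of l] less.IH[of "l + 1"] less.IH[of "l + 2"] less.IH[of "l + 3"]
        less.IH[of "l + 4"] k unfolding dvd_def by auto
    hence "16 * f k = 2 ^ k * (- a4 + 60 * a3 + 48 * a2 - 640 * a1 - 1024 * a0)"
      unfolding k rec by (simp add: power_add algebra_simps)
    thus ?thesis by simp
  qed
qed

text \<open>
  For \<open>m = 2\<^sup>k u\<close> with \<open>u\<close> odd this is \<open>16 t6_int (m - j) / 2\<^sup>k\<close>; the division is exact for
  \<open>1 \<le> j \<le> 5\<close>, and the factor 16 accounts for the initial values \<open>k \<le> 4\<close> of the recurrence in \<open>k\<close>.
\<close>
definition scaled_t6 :: "int \<Rightarrow> int \<Rightarrow> int" where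
  "scaled_t6 j m = 16 * t6_int (m - j) div 2 ^ multiplicity 2 m"

lemma t6_int_eq_scaled_t6:
  assumes "j \<in> {1..5}"
  shows "16 * t6_int (2 ^ k * m - j) = 2 ^ (k + multiplicity 2 m) * scaled_t6 j (2 ^ k * m)"
proof (cases "m = 0")
  case True
  thus ?thesis using assms by (simp add: scaled_t6_def t6_int_def)
next
  case False
  define v where "v = multiplicity 2 m"
  define u where "u = m div 2 ^ v"
  have u: "m = 2 ^ v * u" "odd u"
    using False multiplicity_decompose[of m 2] by (simp_all add: u_def v_def multiplicity_dvd)
  have mult: "multiplicity 2 (2 ^ k * m) = k + v"
    by (rule multiplicity_decomposeI[of _ _ _ u]) (use u in \<open>simp_all add: power_add\<close>)
  \<comment> \<open>The recurrence starts at the odd part \<open>u\<close>, so that the full power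
    \<open>2 ^ (k + v)\<close> is split off.\<close>
  have "2 ^ (k + v) dvd 16 * t6_int (2 ^ (k + v) * u - j)"
  proof (rule dyadic_recurrence_dvd)
    fix k
    show "t6_int (2 ^ (k + 5) * u - j) = - 2 * t6_int (2 ^ (k + 4) * u - j)
      + 240 * t6_int (2 ^ (k + 3) * u - j) + 384 * t6_int (2 ^ (k + 2) * u - j)
      - 10240 * t6_int (2 ^ (k + 1) * u - j) - 32768 * t6_int (2 ^ k * u - j)"
      using t6_int_dyadic_recurrence[OF assms, of "2 ^ k * u"]
      by (simp add: power_add mult_ac)
  qed
  moreover have "2 ^ (k + v) * u = 2 ^ k * m"
    by (simp add: u(1) power_add)
  ultimately show ?thesis by (simp add: scaled_t6_def mult flip: v_def)
qed

lemma scaled_t6_recurrence: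
  assumes "j \<in> {1..5}"
  shows "scaled_t6 j (32 * m) = - scaled_t6 j (16 * m) + 60 * scaled_t6 j (8 * m)
    + 48 * scaled_t6 j (4 * m) - 640 * scaled_t6 j (2 * m) - 1024 * scaled_t6 j m"
proof -
  define P where "P = (2 :: int) ^ multiplicity 2 m"
  have eq: "16 * t6_int (2 ^ k * m - j) = 2 ^ k * P * scaled_t6 j (2 ^ k * m)" for k
    using t6_int_eq_scaled_t6[OF assms, of k m] by (simp add: P_def power_add)
  \<comment> \<open>This is 16 times the recurrence of \<open>t6_int\<close>, each term rewritten by
    \<open>eq\<close>.\<close>
  have "P * 32 * scaled_t6 j (32 * m) = P * 32 * (- scaled_t6 j (16 * m) + 60 * scaled_t6 j (8 * m)
    + 48 * scaled_t6 j (4 * m) - 640 * scaled_t6 j (2 * m) - 1024 * scaled_t6 j m)"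
    using t6_int_dyadic_recurrence[OF assms, of m] eq[of 0] eq[of 1] eq[of 2] eq[of 3] eq[of 4] eq[of 5]
    by (simp add: algebra_simps)
  moreover have "P * 32 \<noteq> 0" by (simp add: P_def)
  ultimately show ?thesis using mult_cancel_left by blast
qed

section \<open>Exact powers of 2 in the normalised coefficients\<close>

lemma scaled_t6_odd:
  assumes "odd m" "j \<in> {1..5}"
  shows "2 ^ k * scaled_t6 j (2 ^ k * m) = 16 * t6_int (2 ^ k * m - j)"
  using t6_int_eq_scaled_t6[OF assms(2), of k m] not_dvd_imp_multiplicity_0[OF assms(1)] by simp

text \<open>Iterated doubling, with 4 pulled out for \<open>j = 2, 4\<close>, 8 for
  \<open>j = 3\<close> and 32 for \<open>j = 1, 5\<close>. The brackets then agree with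
  \<open>t6_int (m - 1) + t6_int (m - 5)\<close> modulo 2. The exceptions are
  \<open>j = 1, 5\<close> at \<open>4 * m\<close>: there the value is divisible by 64, so the
  pattern starts only at \<open>8 * m\<close>.\<close>

lemma scaled_t6_initial:
  assumes "odd m"
  shows
    "scaled_t6 1 (4 * m) = 4 * (16 * t6_int (m - 1) - 144 * t6_int (m - 2) - 144 * t6_int (m - 3) + 16 * t6_int (m - 4))"
    "scaled_t6 2 (4 * m) = 4 * (9 * t6_int (m - 1) + 116 * t6_int (m - 2) - 66 * t6_int (m - 3) - 60 * t6_int (m - 4) + t6_int (m - 5))"
    "scaled_t6 3 (4 * m) = 8 * (- 3 * t6_int (m - 1) + 12 * t6_int (m - 2) + 110 * t6_int (m - 3) + 12 * t6_int (m - 4) - 3 * t6_int (m - 5))"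
    "scaled_t6 4 (4 * m) = 4 * (t6_int (m - 1) - 60 * t6_int (m - 2) - 66 * t6_int (m - 3) + 116 * t6_int (m - 4) + 9 * t6_int (m - 5))"
    "scaled_t6 5 (4 * m) = 4 * (16 * t6_int (m - 2) - 144 * t6_int (m - 3) - 144 * t6_int (m - 4) + 16 * t6_int (m - 5))"
    "scaled_t6 1 (8 * m) = 32 * (- 15 * t6_int (m - 1) - 100 * t6_int (m - 2) + 54 * t6_int (m - 3) + 60 * t6_int (m - 4) + t6_int (m - 5))"
    "scaled_t6 2 (8 * m) = 4 * (31 * t6_int (m - 1) + 948 * t6_int (m - 2) + 1050 * t6_int (m - 3) - 204 * t6_int (m - 4) - 33 * t6_int (m - 5))"
    "scaled_t6 3 (8 * m) = 8 * (15 * t6_int (m - 1) - 204 * t6_int (m - 2) - 902 * t6_int (m - 3) - 204 * t6_int (m - 4) + 15 * t6_int (m - 5))"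
    "scaled_t6 4 (8 * m) = 4 * (- 33 * t6_int (m - 1) - 204 * t6_int (m - 2) + 1050 * t6_int (m - 3) + 948 * t6_int (m - 4) + 31 * t6_int (m - 5))"
    "scaled_t6 5 (8 * m) = 32 * (t6_int (m - 1) + 60 * t6_int (m - 2) + 54 * t6_int (m - 3) - 100 * t6_int (m - 4) - 15 * t6_int (m - 5))"
    "scaled_t6 1 (16 * m) = 32 * (- 5 * t6_int (m - 1) - 732 * t6_int (m - 2) - 798 * t6_int (m - 3) + 228 * t6_int (m - 4) + 27 * t6_int (m - 5))"
    "scaled_t6 2 (16 * m) = 4 * (381 * t6_int (m - 1) + 3548 * t6_int (m - 2) - 4914 * t6_int (m - 3) - 3876 * t6_int (m - 4) - 3 * t6_int (m - 5))"
    "scaled_t6 3 (16 * m) = 8 * (- 147 * t6_int (m - 1) + 924 * t6_int (m - 2) + 5870 * t6_int (m - 3) + 924 * t6_int (m - 4) - 147 * t6_int (m - 5))"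
    "scaled_t6 4 (16 * m) = 4 * (- 3 * t6_int (m - 1) - 3876 * t6_int (m - 2) - 4914 * t6_int (m - 3) + 3548 * t6_int (m - 4) + 381 * t6_int (m - 5))"
    "scaled_t6 5 (16 * m) = 32 * (27 * t6_int (m - 1) + 228 * t6_int (m - 2) - 798 * t6_int (m - 3) - 732 * t6_int (m - 4) - 5 * t6_int (m - 5))"
proof -
  note double = t6_int_double_minus[of m] t6_int_double_minus[of "2 * m"]
    t6_int_double_minus[of "4 * m"] t6_int_double_minus[of "8 * m"]
  show "scaled_t6 1 (4 * m) = 4 * (16 * t6_int (m - 1) - 144 * t6_int (m - 2) - 144 * t6_int (m - 3) + 16 * t6_int (m - 4))"
    using scaled_t6_odd[OF assms, of 1 2] double by simp
  show "scaled_t6 2 (4 * m) = 4 * (9 * t6_int (m - 1) + 116 * t6_int (m - 2) - 66 * t6_int (m - 3) - 60 * t6_int (m - 4) + t6_int (m - 5))"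
    using scaled_t6_odd[OF assms, of 2 2] double by simp
  show "scaled_t6 3 (4 * m) = 8 * (- 3 * t6_int (m - 1) + 12 * t6_int (m - 2) + 110 * t6_int (m - 3) + 12 * t6_int (m - 4) - 3 * t6_int (m - 5))"
    using scaled_t6_odd[OF assms, of 3 2] double by simp
  show "scaled_t6 4 (4 * m) = 4 * (t6_int (m - 1) - 60 * t6_int (m - 2) - 66 * t6_int (m - 3) + 116 * t6_int (m - 4) + 9 * t6_int (m - 5))"
    using scaled_t6_odd[OF assms, of 4 2] double by simp
  show "scaled_t6 5 (4 * m) = 4 * (16 * t6_int (m - 2) - 144 * t6_int (m - 3) - 144 * t6_int (m - 4) + 16 * t6_int (m - 5))"
    using scaled_t6_odd[OF assms, of 5 2] double by simp
  show "scaled_t6 1 (8 * m) = 32 * (- 15 * t6_int (m - 1) - 100 * t6_int (m - 2) + 54 * t6_int (m - 3) + 60 * t6_int (m - 4) + t6_int (m - 5))"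
    using scaled_t6_odd[OF assms, of 1 3] double by simp
  show "scaled_t6 2 (8 * m) = 4 * (31 * t6_int (m - 1) + 948 * t6_int (m - 2) + 1050 * t6_int (m - 3) - 204 * t6_int (m - 4) - 33 * t6_int (m - 5))"
    using scaled_t6_odd[OF assms, of 2 3] double by simp
  show "scaled_t6 3 (8 * m) = 8 * (15 * t6_int (m - 1) - 204 * t6_int (m - 2) - 902 * t6_int (m - 3) - 204 * t6_int (m - 4) + 15 * t6_int (m - 5))"
    using scaled_t6_odd[OF assms, of 3 3] double by simp
  show "scaled_t6 4 (8 * m) = 4 * (- 33 * t6_int (m - 1) - 204 * t6_int (m - 2) + 1050 * t6_int (m - 3) + 948 * t6_int (m - 4) + 31 * t6_int (m - 5))"
    using scaled_t6_odd[OF assms, of 4 3] double by simp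
  show "scaled_t6 5 (8 * m) = 32 * (t6_int (m - 1) + 60 * t6_int (m - 2) + 54 * t6_int (m - 3) - 100 * t6_int (m - 4) - 15 * t6_int (m - 5))"
    using scaled_t6_odd[OF assms, of 5 3] double by simp
  show "scaled_t6 1 (16 * m) = 32 * (- 5 * t6_int (m - 1) - 732 * t6_int (m - 2) - 798 * t6_int (m - 3) + 228 * t6_int (m - 4) + 27 * t6_int (m - 5))"
    using scaled_t6_odd[OF assms, of 1 4] double by simp
  show "scaled_t6 2 (16 * m) = 4 * (381 * t6_int (m - 1) + 3548 * t6_int (m - 2) - 4914 * t6_int (m - 3) - 3876 * t6_int (m - 4) - 3 * t6_int (m - 5))"
    using scaled_t6_odd[OF assms, of 2 4] double by simp
  show "scaled_t6 3 (16 * m) = 8 * (- 147 * t6_int (m - 1) + 924 * t6_int (m - 2) + 5870 * t6_int (m - 3) + 924 * t6_int (m - 4) - 147 * t6_int (m - 5))"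
    using scaled_t6_odd[OF assms, of 3 4] double by simp
  show "scaled_t6 4 (16 * m) = 4 * (- 3 * t6_int (m - 1) - 3876 * t6_int (m - 2) - 4914 * t6_int (m - 3) + 3548 * t6_int (m - 4) + 381 * t6_int (m - 5))"
    using scaled_t6_odd[OF assms, of 4 4] double by simp
  show "scaled_t6 5 (16 * m) = 32 * (27 * t6_int (m - 1) + 228 * t6_int (m - 2) - 798 * t6_int (m - 3) - 732 * t6_int (m - 4) - 5 * t6_int (m - 5))"
    using scaled_t6_odd[OF assms, of 5 4] double by simp
qed

text \<open>Modulo \<open>2 * r\<close> only the coefficient -1 survives, so the valuation persists.
  For \<open>g 2\<close> divisibility by 4 is enough, since \<open>48 * 4\<close> is a multiple of
  64.\<close>

lemma dyadic_recurrence_odd_multiple: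
  fixes g :: "nat \<Rightarrow> int"
  assumes rec: "\<And>k. g (k + 5) = - g (k + 4) + 60 * g (k + 3) + 48 * g (k + 2)
    - 640 * g (k + 1) - 1024 * g k"
    and r: "r \<in> {4, 8, 32}"
    and init: "4 dvd g 2" "\<exists>x. odd x \<and> g 3 = r * x" "\<exists>x. odd x \<and> g 4 = r * x"
    and "k \<ge> 3"
  shows "\<exists>x. odd x \<and> g k = r * x"
  using \<open>k \<ge> 3\<close>
proof (induction k rule: less_induct)
  case (less k)
  show ?case
  proof (cases "k < 5")
    case True
    with less.prems have "k = 3 \<or> k = 4" by auto
    with init show ?thesis by blast
  next
    case False
    define l where "l = k - 5"
    have k: "k = l + 5" using False by (simp add: l_def)
    obtain x where x: "odd x" "g (l + 4) = r * x" using less.IH[of "l + 4"] k by auto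
    obtain y where y: "g (l + 3) = r * y" using less.IH[of "l + 3"] k by auto
    have "4 dvd g (l + 2)"
    proof (cases "l = 0")
      case True
      thus ?thesis using init by (simp add: numeral_2_eq_2)
    next
      case False
      then obtain z where "g (l + 2) = r * z" using less.IH[of "l + 2"] k by auto
      moreover have "4 dvd r" using r by auto
      ultimately show ?thesis by simp
    qed
    then obtain z where z: "g (l + 2) = 4 * z" by (elim dvdE)
    \<comment> \<open>The quotients are exact and even, also for \<open>r = 32\<close>, where they
      are 6, 20 and 32.\<close>
    define w where "w = - x + 60 * y + (192 div r) * z - (640 div r) * g (l + 1) - (1024 div r) * g l"
    have "odd w" using r x(1) by (auto simp: w_def)
    moreover have "g k = r * w"
      using r unfolding k rec x(2) y z w_def by (auto simp: algebra_simps)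
    ultimately show ?thesis by blast
  qed
qed

lemma scaled_t6_odd_multiple:
  assumes "odd m" "m > 0"
  shows "k \<ge> 2 \<Longrightarrow> \<exists>x. odd x \<and> scaled_t6 2 (2 ^ k * m) = 4 * x"
    and "k \<ge> 2 \<Longrightarrow> \<exists>x. odd x \<and> scaled_t6 3 (2 ^ k * m) = 8 * x"
    and "k \<ge> 2 \<Longrightarrow> \<exists>x. odd x \<and> scaled_t6 4 (2 ^ k * m) = 4 * x"
    and "k \<ge> 3 \<Longrightarrow> \<exists>x. odd x \<and> scaled_t6 1 (2 ^ k * m) = 32 * x"
    and "k \<ge> 3 \<Longrightarrow> \<exists>x. odd x \<and> scaled_t6 5 (2 ^ k * m) = 32 * x"
proof -
  note init = scaled_t6_initial[OF assms(1)]
  note parity = odd_t6_int_sum[OF assms]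
  have stable: "\<exists>x. odd x \<and> scaled_t6 j (2 ^ k * m) = r * x"
    if "j \<in> {1..5}" "r \<in> {4, 8, 32}" "4 dvd scaled_t6 j (4 * m)"
      "scaled_t6 j (8 * m) = r * x" "odd x" "scaled_t6 j (16 * m) = r * y" "odd y" "k \<ge> 3"
    for j r x y k
  proof (rule dyadic_recurrence_odd_multiple[where g = "\<lambda>k. scaled_t6 j (2 ^ k * m)"])
    fix k
    show "scaled_t6 j (2 ^ (k + 5) * m) = - scaled_t6 j (2 ^ (k + 4) * m)
      + 60 * scaled_t6 j (2 ^ (k + 3) * m) + 48 * scaled_t6 j (2 ^ (k + 2) * m)
      - 640 * scaled_t6 j (2 ^ (k + 1) * m) - 1024 * scaled_t6 j (2 ^ k * m)"
      using scaled_t6_recurrence[OF that(1), of "2 ^ k * m"] by (simp add: power_add mult_ac)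
  qed (use that in auto)
  show "\<exists>x. odd x \<and> scaled_t6 2 (2 ^ k * m) = 4 * x" if "k \<ge> 2"
  proof (cases "k = 2")
    case True
    have "\<exists>x. odd x \<and> scaled_t6 2 (4 * m) = 4 * x"
      \<comment> \<open>Unification with the initial value supplies the witness, whose parity is
        given by \<open>parity\<close>.\<close>
      by (rule exI, rule conjI[rotated], rule init(2)) (use parity in simp)
    with True show ?thesis by simp
  next
    case False
    show ?thesis
      by (rule stable[OF _ _ _ init(7) _ init(12)]) (use parity that False in \<open>simp_all add: init(2)\<close>)
  qed
  show "\<exists>x. odd x \<and> scaled_t6 3 (2 ^ k * m) = 8 * x" if "k \<ge> 2"
  proof (cases "k = 2")
    case True
    have "\<exists>x. odd x \<and> scaled_t6 3 (4 * m) = 8 * x"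
      by (rule exI, rule conjI[rotated], rule init(3)) (use parity in simp)
    with True show ?thesis by simp
  next
    case False
    show ?thesis
      by (rule stable[OF _ _ _ init(8) _ init(13)]) (use parity that False in \<open>simp_all add: init(3)\<close>)
  qed
  show "\<exists>x. odd x \<and> scaled_t6 4 (2 ^ k * m) = 4 * x" if "k \<ge> 2"
  proof (cases "k = 2")
    case True
    have "\<exists>x. odd x \<and> scaled_t6 4 (4 * m) = 4 * x"
      by (rule exI, rule conjI[rotated], rule init(4)) (use parity in simp)
    with True show ?thesis by simp
  next
    case False
    show ?thesis
      by (rule stable[OF _ _ _ init(9) _ init(14)]) (use parity that False in \<open>simp_all add: init(4)\<close>)
  qed
  show "\<exists>x. odd x \<and> scaled_t6 1 (2 ^ k * m) = 32 * x" if "k \<ge> 3"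
    by (rule stable[OF _ _ _ init(6) _ init(11)]) (use parity that in \<open>simp_all add: init(1)\<close>)
  show "\<exists>x. odd x \<and> scaled_t6 5 (2 ^ k * m) = 32 * x" if "k \<ge> 3"
    by (rule stable[OF _ _ _ init(10) _ init(15)]) (use parity that in \<open>simp_all add: init(5)\<close>)
qed

section \<open>Valuations\<close>

lemma nu2_eqI: "x = 2 ^ k * y \<Longrightarrow> odd y \<Longrightarrow> nu2 x = enat k"
  using multiplicity_decomposeI[of x 2 k y] by (auto simp: nu2_def)

lemma odd_part_eqI: "x = 2 ^ k * y \<Longrightarrow> odd y \<Longrightarrow> odd_part x = y"
  using multiplicity_decomposeI[of x 2 k y] by (auto simp: odd_part_def)

lemma choose_5_product:
  "120 * int ((n + 5) choose 5) = (int n + 1) * (int n + 2) * (int n + 3) * (int n + 4) * (int n + 5)"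
proof -
  have fact_5: "fact 5 = (120 :: nat)" by (simp add: fact_numeral)
  have Suc: "n + 5 = Suc (n + 4)" "n + 4 = Suc (n + 3)" "n + 3 = Suc (n + 2)"
    "n + 2 = Suc (n + 1)" "n + 1 = Suc n" by simp_all
  have "fact (n + 5) = (n + 5) * ((n + 4) * ((n + 3) * ((n + 2) * ((n + 1) * fact n))))"
    unfolding Suc fact_Suc of_nat_id ..
  moreover have "fact 5 * fact (n + 5 - 5) * ((n + 5) choose 5) = (fact (n + 5) :: nat)"
    by (rule binomial_fact_lemma) simp
  ultimately have "fact n * (120 * ((n + 5) choose 5)) =
      fact n * ((n + 1) * (n + 2) * (n + 3) * (n + 4) * (n + 5))"
    unfolding fact_5 add_diff_cancel_right' by (simp only: mult_ac)
  hence "120 * ((n + 5) choose 5) = (n + 1) * (n + 2) * (n + 3) * (n + 4) * (n + 5)"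
    by (simp only: mult_cancel1 fact_nonzero simp_thms)
  hence "int (120 * ((n + 5) choose 5)) = int ((n + 1) * (n + 2) * (n + 3) * (n + 4) * (n + 5))"
    by (rule arg_cong)
  thus ?thesis by (simp only: of_nat_mult of_nat_add of_nat_numeral of_nat_1)
qed

text \<open>The product of the five factors is \<open>120 = 8 * 15\<close> times the binomial
  coefficient, hence the offset 3.\<close>

lemma nu2_choose_5:
  assumes "int n + 1 = 2 ^ e1 * y1" "int n + 2 = 2 ^ e2 * y2" "int n + 3 = 2 ^ e3 * y3"
    "int n + 4 = 2 ^ e4 * y4" "int n + 5 = 2 ^ e5 * y5"
    and "odd y1" "odd y2" "odd y3" "odd y4" "odd y5"
    and e: "e1 + e2 + e3 + e4 + e5 = k + 3"
  shows "nu2 (int ((n + 5) choose 5)) = enat k"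
proof -
  let ?C = "int ((n + 5) choose 5)" and ?y = "y1 * y2 * y3 * y4 * y5"
  have "120 * ?C = 2 ^ (e1 + e2 + e3 + e4 + e5) * ?y"
    unfolding choose_5_product assms(1-5) by (simp add: power_add mult_ac)
  hence "15 * ?C = 2 ^ k * ?y" unfolding e by (simp add: power_add)
  from multiplicity_decomposeI[OF this] have "multiplicity 2 (15 * ?C) = k"
    using assms(6-10) by simp
  moreover have "multiplicity 2 (15 * ?C) = multiplicity 2 ?C"
    by (rule multiplicity_prime_elem_times_other) auto
  ultimately show ?thesis by (simp add: nu2_def)
qed

text \<open>
  Among \<open>n + 1, \<dots>, n + 5\<close> the entry \<open>n + j\<close> selected here is divisible by 4, and by 8 when
  \<open>n \<equiv> 3 (mod 4)\<close>, where both \<open>n + 1\<close> and \<open>n + 5\<close> are divisible by 4. Then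
  \<open>2\<^sup>c\<close> is the exact power of 2 dividing \<open>scaled_t6 j (n + j)\<close>.
\<close>
definition anchors :: "(int \<times> int \<times> nat) set" where
  "anchors = {(0, 4, 2), (4, 4, 2), (1, 3, 3), (5, 3, 3), (2, 2, 2), (6, 2, 2), (7, 1, 5), (3, 5, 5)}"

lemma ex_anchor: "\<exists>j c. (int n mod 8, j, c) \<in> anchors"
proof -
  have "int n mod 8 = 0 \<or> int n mod 8 = 1 \<or> int n mod 8 = 2 \<or> int n mod 8 = 3 \<or>
      int n mod 8 = 4 \<or> int n mod 8 = 5 \<or> int n mod 8 = 6 \<or> int n mod 8 = 7"
    by presburger
  thus ?thesis unfolding anchors_def by (elim disjE) simp_all
qed

text \<open>Since \<open>n = (n + j) - j\<close>, \<open>16 * t6 n\<close> equals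
  \<open>2 ^ k * scaled_t6 j (n + j)\<close> and has valuation \<open>k + c\<close>.\<close>

lemma anchor_factorization:
  assumes anchor: "(int n mod 8, j, c) \<in> anchors"
  obtains k u x where "int n + j = 2 ^ k * u" "odd u" "k \<ge> 2"
    "odd x" "scaled_t6 j (int n + j) = 2 ^ c * x" "t6 n = 2 ^ (k + c - 4) * x"
proof -
  define k where "k = multiplicity 2 (int n + j)"
  define u where "u = (int n + j) div 2 ^ k"
  have pos: "int n + j > 0" using anchor by (auto simp: anchors_def)
  have u: "int n + j = 2 ^ k * u" "odd u"
    using multiplicity_decompose[of "int n + j" 2] pos by (simp_all add: u_def k_def multiplicity_dvd)
  have "u > 0" using pos u(1) by (simp add: zero_less_mult_iff)
  have "4 dvd int n + j"
    using anchor unfolding anchors_def insert_iff prod.inject empty_iff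
    by (elim disjE; simp; presburger)
  hence "2 ^ 2 dvd int n + j" by simp
  hence k2: "k \<ge> 2" unfolding k_def using pos by (intro multiplicity_geI) auto
  \<comment> \<open>\<open>c = 5\<close> belongs to \<open>j = 1\<close> and \<open>j = 5\<close>,
    whose exact power is known only from \<open>k = 3\<close> on.\<close>
  have k3: "k \<ge> 3" if "c = 5"
  proof -
    have "8 dvd int n + j"
      using anchor that unfolding anchors_def insert_iff prod.inject empty_iff
      by (elim disjE; simp; presburger)
    hence "2 ^ 3 dvd int n + j" by simp
    thus ?thesis unfolding k_def using pos by (intro multiplicity_geI) auto
  qed
  have "\<exists>x. odd x \<and> scaled_t6 j (2 ^ k * u) = 2 ^ c * x"
    using anchor unfolding anchors_def insert_iff prod.inject empty_iff
    by (elim disjE)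
      (use scaled_t6_odd_multiple[OF \<open>odd u\<close> \<open>u > 0\<close>, of k] k2 k3 in simp_all)
  then obtain x where x: "odd x" "scaled_t6 j (2 ^ k * u) = 2 ^ c * x" by blast
  have j: "j \<in> {1..5}" "c \<ge> 2" using anchor by (auto simp: anchors_def)
  have "16 * t6_int (int n) = 2 ^ (k + c) * x"
    using scaled_t6_odd[OF \<open>odd u\<close> j(1), of k] x(2) by (simp add: power_add flip: u(1))
  also have "k + c = (k + c - 4) + 4" using k2 j(2) by simp
  finally have "16 * t6 n = 16 * (2 ^ (k + c - 4) * x)"
    by (simp only: power_add) (simp add: t6_int_def)
  hence "t6 n = 2 ^ (k + c - 4) * x" by simp
  with that[OF u k2 x(1)] x(2) u(1) show ?thesis by simp
qed

text \<open>The valuations of the other four of \<open>n + 1\<close>, ..., \<open>n + 5\<close> are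
  fixed by the residue of \<open>n\<close>; they sum to 1, 2, 1, 3, 3 in the five cases. The
  binomial coefficient thus has valuation \<open>k - 2\<close>, \<open>k - 1\<close>,
  \<open>k - 2\<close>, \<open>k\<close>, \<open>k\<close>, against \<open>k + c - 4\<close> for
  \<open>t6 n\<close>.\<close>

lemma nu2_t6: "nu2 (t6 n) = nu2 (int ((n + 5) choose 5)) + of_bool [n = 3] (mod 4)"
proof -
  obtain j c where anchor: "(int n mod 8, j, c) \<in> anchors" using ex_anchor by blast
  then obtain k u x where u: "int n + j = 2 ^ k * u" "odd u" "k \<ge> 2"
    and x: "odd x" "t6 n = 2 ^ (k + c - 4) * x"
    by (rule anchor_factorization) blast
  have nu: "nu2 (t6 n) = enat (k + c - 4)" using x(2,1) by (rule nu2_eqI)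
  define q where "q = int n div 4"
  define p where "p = int n div 8"
  \<comment> \<open>Residues differing by 4 modulo 8 share \<open>j\<close> and \<open>c\<close>,
    except 3 and 7.\<close>
  have "(int n = 4 * q \<and> j = 4 \<and> c = 2) \<or> (int n = 4 * q + 1 \<and> j = 3 \<and> c = 3)
    \<or> (int n = 4 * q + 2 \<and> j = 2 \<and> c = 2) \<or> (int n = 8 * p + 7 \<and> j = 1 \<and> c = 5)
    \<or> (int n = 8 * p + 3 \<and> j = 5 \<and> c = 5)"
    using anchor unfolding anchors_def q_def p_def insert_iff prod.inject empty_iff
    by (elim disjE; simp; presburger)
  then consider "int n = 4 * q" "j = 4" "c = 2" | "int n = 4 * q + 1" "j = 3" "c = 3"
    | "int n = 4 * q + 2" "j = 2" "c = 2" | "int n = 8 * p + 7" "j = 1" "c = 5"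
    | "int n = 8 * p + 3" "j = 5" "c = 5"
    by blast
  thus ?thesis
  proof cases
    case 1
    hence "nu2 (int ((n + 5) choose 5)) = enat (k - 2)"
      using u by (intro nu2_choose_5[of n 0 "4 * q + 1" 1 "2 * q + 1" 0 "4 * q + 3" k u 0 "4 * q + 5"]) auto
    moreover have "\<not> [n = 3] (mod 4)" using 1(1) unfolding cong_def by presburger
    ultimately show ?thesis using nu 1 u(3) by (simp add: one_enat_def)
  next
    case 2
    hence "nu2 (int ((n + 5) choose 5)) = enat (k - 1)"
      using u by (intro nu2_choose_5[of n 1 "2 * q + 1" 0 "4 * q + 3" k u 0 "4 * q + 5" 1 "2 * q + 3"]) auto
    moreover have "\<not> [n = 3] (mod 4)" using 2(1) unfolding cong_def by presburger
    ultimately show ?thesis using nu 2 u(3) by (simp add: one_enat_def)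
  next
    case 3
    hence "nu2 (int ((n + 5) choose 5)) = enat (k - 2)"
      using u by (intro nu2_choose_5[of n 0 "4 * q + 3" k u 0 "4 * q + 5" 1 "2 * q + 3" 0 "4 * q + 7"]) auto
    moreover have "\<not> [n = 3] (mod 4)" using 3(1) unfolding cong_def by presburger
    ultimately show ?thesis using nu 3 u(3) by (simp add: one_enat_def)
  next
    case 4
    hence "nu2 (int ((n + 5) choose 5)) = enat k"
      using u by (intro nu2_choose_5[of n k u 0 "8 * p + 9" 1 "4 * p + 5" 0 "8 * p + 11" 2 "2 * p + 3"]) auto
    moreover have "[n = 3] (mod 4)" using 4(1) unfolding cong_def by presburger
    ultimately show ?thesis using nu 4 u(3) by (simp add: one_enat_def)
  next
    case 5
    hence "nu2 (int ((n + 5) choose 5)) = enat k"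
      using u by (intro nu2_choose_5[of n 2 "2 * p + 1" 0 "8 * p + 5" 1 "4 * p + 3" 0 "8 * p + 7" k u]) auto
    moreover have "[n = 3] (mod 4)" using 5(1) unfolding cong_def by presburger
    ultimately show ?thesis using nu 5 u(3) by (simp add: one_enat_def)
  qed
qed

section \<open>Automaticity\<close>

text \<open>The values of \<open>H\<close>, numbered by \<open>enc\<close>, are the states;
  \<open>step\<close> makes transitions independent of the representative chosen.\<close>

lemma two_automaticI:
  fixes H :: "nat \<Rightarrow> 'b" and a :: "nat \<Rightarrow> 'a"
  assumes fin: "finite (range H)"
    and step: "\<And>n n' d. H n = H n' \<Longrightarrow> d \<in> {0, 1} \<Longrightarrow> H (2 * n + d) = H (2 * n' + d)"
    and out: "\<And>n n'. H n = H n' \<Longrightarrow> a n = a n'"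
  shows "two_automatic a"
proof -
  obtain enc :: "'b \<Rightarrow> nat" where enc: "inj_on enc (range H)"
    using finite_imp_inj_to_nat_seg[OF fin] by auto
  define G where "G = (\<lambda>n. enc (H n))"
  have G_eq: "G n = G n' \<longleftrightarrow> H n = H n'" for n n'
    using enc by (auto simp: G_def inj_on_def)
  define rep where "rep = (\<lambda>q. SOME n. G n = q)"
  have rep: "H (rep (G n)) = H n" for n
    unfolding G_eq [symmetric] rep_def by (rule someI[of _ n]) simp
  define \<delta> where "\<delta> = (\<lambda>q d. G (2 * rep q + d))"
  have \<delta>: "\<delta> (G n) d = G (2 * n + d)" if "d \<in> {0, 1}" for n d
    using step[OF rep that] by (simp add: \<delta>_def G_eq)
  have run: "foldl \<delta> (G 0) (binary_digits n) = G n" for n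
  proof (induction n rule: less_induct)
    case (less n)
    show ?case
    proof (cases "n = 0")
      case True
      thus ?thesis by (simp add: binary_digits.simps)
    next
      case False
      hence "foldl \<delta> (G 0) (binary_digits n) = \<delta> (G (n div 2)) (n mod 2)"
        using less[of "n div 2"] by (subst binary_digits.simps) simp
      also have "\<dots> = G (2 * (n div 2) + n mod 2)" by (rule \<delta>) auto
      finally show ?thesis by simp
    qed
  qed
  have "finite (range G)"
    using finite_imageI[OF fin, of enc] by (simp add: G_def image_image)
  moreover have "\<delta> q d \<in> range G" for q d by (simp add: \<delta>_def)
  moreover have "a n = a (rep (foldl \<delta> (G 0) (binary_digits n)))" for n
    unfolding run by (rule out) (simp add: rep)
  ultimately show ?thesis
    unfolding two_automatic_def
    by (intro exI[of _ "range G"] exI[of _ "G 0"] exI[of _ \<delta>] exI[of _ "\<lambda>q. a (rep q)"]) auto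
qed

section \<open>The finite state and its update\<close>

lemma t6_int_dyadic_cong:
  assumes "\<And>j. j \<in> {1..5} \<Longrightarrow> [t6_int (m - j) = t6_int (m' - j)] (mod M)"
    and "j \<in> {1..5}"
  shows "[t6_int (2 ^ r * m - j) = t6_int (2 ^ r * m' - j)] (mod M)"
  using \<open>j \<in> {1..5}\<close>
proof (induction r arbitrary: j)
  case 0
  thus ?case using assms by simp
next
  case (Suc r)
  have c: "[t6_int (2 ^ r * m - i) = t6_int (2 ^ r * m' - i)] (mod M)" if "i \<in> {1, 2, 3, 4, 5}" for i
    using Suc.IH[of i] that by auto
  have "j = 1 \<or> j = 2 \<or> j = 3 \<or> j = 4 \<or> j = 5" using Suc.prems by auto
  thus ?case
    using t6_int_double_minus[of "2 ^ r * m"] t6_int_double_minus[of "2 ^ r * m'"]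
    by (elim disjE) (auto simp: mult.assoc intro!: cong_add cong_diff cong_mult cong_minus_minus_iff[THEN iffD2] c)
qed

text \<open>
  Doubling \<open>n\<close> shifts the index \<open>r\<close>, and the order 5 recurrence closes the range \<open>r < 5\<close>; at odd
  arguments \<open>scaled_t6\<close> is expressed by \<open>t6_int\<close> itself, which is why the window of \<open>t6_int\<close> is needed.
\<close>
definition t6_state :: "int \<Rightarrow> nat \<Rightarrow> int \<times> int list \<times> int list" where
  "t6_state M n = (int n mod 8, map (\<lambda>d. t6_int (int n + d) mod M) [-5..5],
     map (\<lambda>(j, r, d). scaled_t6 j (2 ^ r * (int n + d)) mod M)
       (List.product [1..5] (List.product [0..<5] [1..5])))"

lemma t6_state_eq_iff:
  "t6_state M n = t6_state M n' \<longleftrightarrow> [int n = int n'] (mod 8) \<and>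
     (\<forall>d\<in>{-5..5}. [t6_int (int n + d) = t6_int (int n' + d)] (mod M)) \<and>
     (\<forall>j\<in>{1..5}. \<forall>r<5. \<forall>d\<in>{1..5}.
        [scaled_t6 j (2 ^ r * (int n + d)) = scaled_t6 j (2 ^ r * (int n' + d))] (mod M))"
  unfolding t6_state_def cong_def prod.inject map_eq_conv set_upto set_product set_upt
  by fastforce

lemma finite_range_t6_state:
  assumes "M > 0"
  shows "finite (range (t6_state M))"
proof -
  \<comment> \<open>The two lists have 11 and \<open>5 * 5 * 5 = 125\<close> entries.\<close>
  let ?L = "{xs. set xs \<subseteq> {0..<M} \<and> length xs \<le> 125}"
  have "range (t6_state M) \<subseteq> {0..<8} \<times> ?L \<times> ?L"
    using assms by (auto simp: t6_state_def)
  moreover have "finite ({0..<8 :: int} \<times> ?L \<times> ?L)"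
    by (intro finite_cartesian_product finite_lists_length_le) auto
  ultimately show ?thesis by (rule finite_subset)
qed

lemma t6_state_step:
  assumes eq: "t6_state M n = t6_state M n'" and e: "e \<in> {0, 1}"
  shows "t6_state M (2 * n + e) = t6_state M (2 * n' + e)"
proof -
  have res: "[int n = int n'] (mod 8)"
    and t: "\<And>d. d \<in> {-5..5} \<Longrightarrow> [t6_int (int n + d) = t6_int (int n' + d)] (mod M)"
    and s: "\<And>j r d. j \<in> {1..5} \<Longrightarrow> r < 5 \<Longrightarrow> d \<in> {1..5} \<Longrightarrow>
      [scaled_t6 j (2 ^ r * (int n + d)) = scaled_t6 j (2 ^ r * (int n' + d))] (mod M)"
    using eq by (simp_all add: t6_state_eq_iff)
  \<comment> \<open>The sums \<open>e + d\<close> range over -5..6. The recursions reach down to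
    \<open>y - 3\<close> for \<open>x = 2 * y\<close> and to \<open>y - 2\<close> for
    \<open>x = 2 * y + 1\<close>, never below -5, so the window reproduces itself.\<close>
  have t': "[t6_int (2 * int n + x) = t6_int (2 * int n' + x)] (mod M)" if x: "x \<in> {-5..6}" for x
  proof (cases "even x")
    case True
    then obtain y where y: "x = 2 * y" by (elim evenE)
    have c: "[t6_int (int n + y - i) = t6_int (int n' + y - i)] (mod M)" if "i \<in> {0..3}" for i
      using t[of "y - i"] that x y by (auto simp: algebra_simps)
    have "2 * int k + x = 2 * (int k + y)" for k by (simp add: y)
    thus ?thesis
      using c[of 0] c[of 1] c[of 2] c[of 3]
      by (simp add: t6_int_double del: distrib_left_numeral) (intro cong_add cong_mult cong_refl)
  next
    case False
    then obtain y where y: "x = 2 * y + 1" by (elim oddE)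
    have c: "[t6_int (int n + y - i) = t6_int (int n' + y - i)] (mod M)" if "i \<in> {0..2}" for i
      using t[of "y - i"] that x y by (auto simp: algebra_simps)
    have "2 * int k + x = 2 * (int k + y) + 1" for k by (simp add: y)
    thus ?thesis
      using c[of 0] c[of 1] c[of 2]
      by (simp add: t6_int_double del: distrib_left_numeral) (intro cong_diff cong_mult cong_refl cong_minus_minus_iff[THEN iffD2])
  qed
  have s': "[scaled_t6 j (2 ^ r * (2 * int n + x)) = scaled_t6 j (2 ^ r * (2 * int n' + x))] (mod M)"
    if j: "j \<in> {1..5}" and r: "r < 5" and x: "x \<in> {1..6}" for j r x
  proof (cases "even x")
    case True
    then obtain y where y: "x = 2 * y" by (elim evenE)
    hence y': "y \<in> {1..5}" using x by auto
    have shift: "2 ^ r * (2 * int k + x) = 2 ^ Suc r * (int k + y)" for k by (simp add: y)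
    show ?thesis
    \<comment> \<open>For \<open>r = 4\<close> the shifted exponent 5 is not stored; the recurrence
      expresses that value by the stored ones.\<close>
    proof (cases "r = 4")
      case False
      thus ?thesis unfolding shift using s[OF j _ y', of "Suc r"] r by simp
    next
      case True
      hence r32: "(2 :: int) ^ Suc r = 32" by simp
      show ?thesis
        unfolding shift r32 scaled_t6_recurrence[OF j]
        using s[OF j _ y', of 0] s[OF j _ y', of 1]
          s[OF j _ y', of 2] s[OF j _ y', of 3] s[OF j _ y', of 4]
        by (simp del: distrib_left_numeral)
          (intro cong_add cong_diff cong_mult cong_refl cong_minus_minus_iff[THEN iffD2])
    qed
  next
    case False
    \<comment> \<open>As \<open>r \<le> 4\<close>, \<open>2 ^ r\<close> divides 16, so no division
      of \<open>t6_int\<close> is involved and the modulus is kept.\<close>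
    have odd_eq: "scaled_t6 j (2 ^ r * u) = 2 ^ (4 - r) * t6_int (2 ^ r * u - j)" if "odd u" for u
    proof -
      have "(16 :: int) = 2 ^ r * 2 ^ (4 - r)"
        using r by (simp flip: power_add)
      hence "2 ^ r * scaled_t6 j (2 ^ r * u) = 2 ^ r * (2 ^ (4 - r) * t6_int (2 ^ r * u - j))"
        using scaled_t6_odd[OF that j, of r] by (simp only: mult.assoc)
      thus ?thesis by simp
    qed
    have "[t6_int (2 * int n + x - i) = t6_int (2 * int n' + x - i)] (mod M)" if "i \<in> {1..5}" for i
      using t'[of "x - i"] that x by (simp add: algebra_simps)
    from t6_int_dyadic_cong[OF this j, of r] show ?thesis
      using False by (auto simp: odd_eq intro!: cong_mult)
  qed
  have "[2 * int n + int e = 2 * int n' + int e] (mod 8)"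
    by (intro cong_add cong_mult res cong_refl)
  moreover have "[t6_int (2 * int n + int e + d) = t6_int (2 * int n' + int e + d)] (mod M)"
    if "d \<in> {-5..5}" for d
    using t'[of "int e + d"] that e by (auto simp: add.assoc)
  moreover have "[scaled_t6 j (2 ^ r * (2 * int n + int e + d)) =
      scaled_t6 j (2 ^ r * (2 * int n' + int e + d))] (mod M)"
    if "j \<in> {1..5}" "r < 5" "d \<in> {1..5}" for j r d
    using s'[of j r "int e + d"] that e by (auto simp: add.assoc)
  ultimately show ?thesis by (simp add: t6_state_eq_iff)
qed

text \<open>Equal states give the same \<open>j\<close> and \<open>c\<close>. Cancelling
  \<open>2 ^ c\<close> with \<open>c \<le> 5\<close> from a congruence modulo
  \<open>2 ^ (s + 5)\<close> leaves at least \<open>2 ^ s\<close>. The exponents \<open>k\<close>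
  and \<open>k'\<close> may differ, since the odd parts are \<open>x\<close> and
  \<open>x'\<close>.\<close>

lemma two_automatic_odd_part_t6: "two_automatic (\<lambda>n. odd_part (t6 n) mod 2 ^ s)"
proof (rule two_automaticI[where H = "t6_state (2 ^ (s + 5))"])
  show "finite (range (t6_state (2 ^ (s + 5))))" by (rule finite_range_t6_state) simp
next
  fix n n' assume eq: "t6_state (2 ^ (s + 5)) n = t6_state (2 ^ (s + 5)) n'"
  obtain j c where anchor: "(int n mod 8, j, c) \<in> anchors" using ex_anchor by blast
  hence j: "j \<in> {1..5}" and c: "c \<le> 5" by (auto simp: anchors_def)
  have "int n mod 8 = int n' mod 8"
    using eq unfolding t6_state_eq_iff cong_def by (elim conjE)
  hence anchor': "(int n' mod 8, j, c) \<in> anchors" using anchor by (simp only:)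
  obtain k x where x: "odd x" "scaled_t6 j (int n + j) = 2 ^ c * x" "t6 n = 2 ^ (k + c - 4) * x"
    using anchor by (rule anchor_factorization)
  obtain k' x' where x': "odd x'" "scaled_t6 j (int n' + j) = 2 ^ c * x'" "t6 n' = 2 ^ (k' + c - 4) * x'"
    using anchor' by (rule anchor_factorization)
  have "\<forall>j\<in>{1..5}. \<forall>r<5. \<forall>d\<in>{1..5}. [scaled_t6 j (2 ^ r * (int n + d)) =
      scaled_t6 j (2 ^ r * (int n' + d))] (mod 2 ^ (s + 5))"
    using eq unfolding t6_state_eq_iff by (elim conjE)
  from this[rule_format, of j 0 j]
  have "[scaled_t6 j (int n + j) = scaled_t6 j (int n' + j)] (mod 2 ^ (s + 5))"
    using j by simp
  hence "2 ^ (s + 5) dvd 2 ^ c * (x - x')"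
    by (simp add: x x' cong_iff_dvd_diff right_diff_distrib)
  moreover have "2 ^ (c + s) dvd (2 :: int) ^ (s + 5)"
    using c by (intro le_imp_power_dvd) simp
  ultimately have "2 ^ c * 2 ^ s dvd 2 ^ c * (x - x')"
    unfolding power_add by (rule dvd_trans[rotated])
  hence "2 ^ s dvd x - x'" by simp
  hence "x mod 2 ^ s = x' mod 2 ^ s" by (simp add: mod_eq_dvd_iff)
  thus "odd_part (t6 n) mod 2 ^ s = odd_part (t6 n') mod 2 ^ s"
    using odd_part_eqI[OF x(3,1)] odd_part_eqI[OF x'(3,1)] by simp
qed (rule t6_state_step)

theorem theorem1p4:
  shows "(\<forall>n :: nat. nu2 (t6 n) = nu2 (int ((n + 5) choose 5)) + of_bool [n = 3] (mod 4)) \<and>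
         (\<forall>s :: nat. s \<ge> 1 \<longrightarrow> two_automatic (\<lambda>n. odd_part (t6 n) mod 2 ^ s))"
  using nu2_t6 two_automatic_odd_part_t6 by blast

end
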